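(* Let $\alpha,\beta,c,d>0$ and $l\ge 0$ be real constants with $\alpha>l$. For a solution $u$ on $\mathbb{R}^+$ of $$\big(|u'|^{l}u'\big)'+c|u'|^{\alpha}u'+d|u|^{\beta}u=0$$ set $E(t)=\frac{l+1}{l+2}|u'(t)|^{l+2}+\frac{d}{\beta+2}|u(t)|^{\beta+2}$. Then there exists a constant $\eta>0$ (independent of $u$) such that every solution $u$ with $E(0)\ne 0$ satisfies $$\liminf_{t\to+\infty}t^{\frac{l+2}{\alpha-l}}E(t)\ge\eta.$$ Moreover: (i) if $\alpha\ge\frac{\beta(1+l)+l}{\beta+2}$, then for every solution there is a constant $C(E(0))$ depending on $E(0)$ such that $$\forall t\ge 1,\quad E(t)\le C(E(0))\,t^{-\frac{l+2}{\alpha-l}};$$ (ii) if $\alpha<\frac{\beta(1+l)+l}{\beta+2}$, then for every solution there is a constant $C(E(0))$ depending on $E(0)$ such that $$\forall t\ge 1,\quad E(t)\le C(E(0))\,t^{-\frac{(\alpha+1)(\beta+2)}{\beta-\alpha}}.$$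
   Context: $\mathbb{R}^+=[0,+\infty)$. A solution on $\mathbb{R}^+$ is a function $u\in\mathcal{C}^1(\mathbb{R}^+)$ with $|u'|^lu'\in\mathcal{C}^1(\mathbb{R}^+)$ which satisfies the equation at every point. The constants $C(E(0))$ depend on the solution only through the value $E(0)$ (and on the parameters $\alpha,\beta,c,d,l$). *)

theory Defs
  imports "HOL-Analysis.Analysis"
begin

text \<open>
  Functions on $[0,+\infty)$ are represented by total functions on the reals of which only the
  values on the set \<open>{0..}\<close> matter. All derivatives are taken within this set, so
  that they are one-sided at \<open>0\<close>.
\<close>

definition deriv_Rplus :: "(real \<Rightarrow> real) \<Rightarrow> real \<Rightarrow> real" where
  "deriv_Rplus f t = vector_derivative f (at t within {0..})"

definition C1_Rplus :: "(real \<Rightarrow> real) \<Rightarrow> bool" where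
  "C1_Rplus f \<longleftrightarrow> f differentiable_on {0..} \<and> continuous_on {0..} (deriv_Rplus f)"

text \<open>
  Note that \<open>0 powr 0 = 0\<close>; this is harmless for \<open>l = 0\<close>, as the power is multiplied by a
  factor that vanishes at the same points.
\<close>

definition is_solution ::
  "real \<Rightarrow> real \<Rightarrow> real \<Rightarrow> real \<Rightarrow> real \<Rightarrow> (real \<Rightarrow> real) \<Rightarrow> bool" where
  "is_solution \<alpha> \<beta> c d l u \<longleftrightarrow>
     C1_Rplus u \<and>
     C1_Rplus (\<lambda>t. \<bar>deriv_Rplus u t\<bar> powr l * deriv_Rplus u t) \<and>
     (\<forall>t\<ge>0. deriv_Rplus (\<lambda>s. \<bar>deriv_Rplus u s\<bar> powr l * deriv_Rplus u s) t
              + c * \<bar>deriv_Rplus u t\<bar> powr \<alpha> * deriv_Rplus u t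
              + d * \<bar>u t\<bar> powr \<beta> * u t = 0)"

definition energy :: "real \<Rightarrow> real \<Rightarrow> real \<Rightarrow> (real \<Rightarrow> real) \<Rightarrow> real \<Rightarrow> real" where
  "energy \<beta> d l u t =
     (l + 1) / (l + 2) * \<bar>deriv_Rplus u t\<bar> powr (l + 2)
     + d / (\<beta> + 2) * \<bar>u t\<bar> powr (\<beta> + 2)"

end

theory Submission
  imports Defs
begin

text \<open>
  Along a solution, \<open>E' = - c \<bar>u'\<bar> powr (\<alpha> + 2)\<close>. Bounding \<open>\<bar>u'\<bar>\<close> by a power of \<open>E\<close> gives
  \<open>E' \<ge> - k E powr (1 + \<gamma>)\<close> with \<open>\<gamma> = (\<alpha> - l) / (l + 2)\<close>, and integrating this inequality yields the
  lower bound. For the upper bounds, one perturbs the energy to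
  \<open>H = E + \<epsilon> \<bar>u\<bar> powr \<theta> u \<bar>u'\<bar> powr l u'\<close>, whose derivative also contains a negative multiple of
  \<open>\<bar>u\<bar> powr (\<theta> + \<beta> + 2)\<close>; the remaining terms are absorbed for small \<open>\<epsilon>\<close>, and
  \<open>H' \<le> - k H powr (1 + \<theta> / (\<beta> + 2))\<close> follows. The smallest exponent \<open>\<theta>\<close> for which this absorption
  works is \<open>(\<beta> + 2) (\<alpha> - l) / (l + 2)\<close> in case (i) and \<open>(\<beta> - \<alpha>) / (\<alpha> + 1)\<close> in case (ii).
\<close>

section \<open>Inequalities between real powers\<close>

lemma powr_le_scaled:
  fixes x S p r :: real
  assumes "0 \<le> x" "x \<le> S" "r \<le> p"
  shows "x powr p \<le> S powr (p - r) * x powr r"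
proof -
  have "x powr p = x powr (p - r) * x powr r"
    by (simp flip: powr_add)
  also have "\<dots> \<le> S powr (p - r) * x powr r"
    using assms by (intro mult_right_mono powr_mono2) auto
  finally show ?thesis .
qed

text \<open>A weighted Young inequality with non-conjugate exponents, at the price of bounding \<open>y\<close>.\<close>

lemma powr_mult_split:
  fixes p q r a \<delta> S :: real
  assumes "p > 0" "a \<ge> 0" "\<delta> > 0" "S > 0" and r: "r \<le> q + q * a / p"
  obtains K where "K > 0"
    "\<And>x y. 0 \<le> x \<Longrightarrow> 0 \<le> y \<Longrightarrow> y \<le> S \<Longrightarrow>
       x powr a * y powr q \<le> \<delta> * x powr (a + p) + K * y powr r"
proof
  define K where "K = \<delta> powr (- (a / p)) * S powr (q + q * a / p - r)"
  show K: "K > 0"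
    unfolding K_def using assms by simp
  fix x y :: real
  assume xy: "0 \<le> x" "0 \<le> y" "y \<le> S"
  show "x powr a * y powr q \<le> \<delta> * x powr (a + p) + K * y powr r"
  \<comment> \<open>If the assumed inequality holds, the first summand alone suffices. Otherwise
    \<open>x\<close> is controlled by a power of \<open>y\<close>, which turns the product into a
    multiple of \<open>y powr (q + q * a / p)\<close>; the bound \<open>y \<le> S\<close> then
    lowers this exponent to \<open>r\<close>.\<close>
  proof (cases "y powr q \<le> \<delta> * x powr p")
    case True
    have "x powr a * y powr q \<le> x powr a * (\<delta> * x powr p)"
      using True by (intro mult_left_mono) auto
    also have "\<dots> = \<delta> * x powr (a + p)"
      by (simp add: powr_add)
    finally show ?thesis
      using K by (smt (verit) mult_nonneg_nonneg powr_ge_zero)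
  next
    case False
    have "x powr a = (x powr p) powr (a / p)"
      using assms by (simp add: powr_powr)
    also have "\<dots> \<le> (y powr q / \<delta>) powr (a / p)"
      using False assms by (intro powr_mono2) (auto simp: field_simps)
    also have "\<dots> = \<delta> powr (- (a / p)) * y powr (q * a / p)"
      using assms by (simp add: powr_divide powr_powr powr_minus field_simps)
    finally have "x powr a * y powr q \<le> \<delta> powr (- (a / p)) * y powr (q * a / p) * y powr q"
      by (intro mult_right_mono) auto
    also have "\<dots> = \<delta> powr (- (a / p)) * y powr (q + q * a / p)"
      by (simp add: powr_add)
    also have "\<dots> \<le> \<delta> powr (- (a / p)) * (S powr (q + q * a / p - r) * y powr r)"
      using powr_le_scaled[OF xy(2,3) r] by (intro mult_left_mono) auto
    finally show ?thesis
      using assms by (simp add: K_def mult.assoc add_increasing)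
  qed
qed

lemma powr_add_le:
  fixes x y p :: real
  assumes "0 \<le> x" "0 \<le> y" "0 \<le> p"
  shows "(x + y) powr p \<le> 2 powr p * (x powr p + y powr p)"
proof -
  have "(x + y) powr p \<le> (2 * max x y) powr p"
    using assms by (intro powr_mono2) auto
  also have "\<dots> = 2 powr p * max x y powr p"
    using assms by (simp add: powr_mult)
  also have "\<dots> \<le> 2 powr p * (x powr p + y powr p)"
    by (intro mult_left_mono) (auto simp: max_def)
  finally show ?thesis .
qed

section \<open>Derivatives of powers of the absolute value\<close>

lemma DERIV_abs_nonzero:
  fixes x :: real
  assumes "x \<noteq> 0"
  shows "(abs has_real_derivative sgn x) (at x)"
proof -
  have "((*) (sgn x) has_real_derivative sgn x) (at x)"
    by (auto intro!: derivative_eq_intros)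
  then show ?thesis
    by (rule has_field_derivative_transform_within[where d = "\<bar>x\<bar>"])
       (use assms in \<open>auto simp: dist_real_def sgn_if\<close>)
qed

text \<open>The point 0, where the chain rule through \<open>abs\<close> fails, is covered too: the
  difference quotient there is \<open>\<bar>h\<bar> powr p\<close>, which tends to 0 because
  \<open>p > 0\<close>.\<close>

lemma DERIV_abs_powr_mult:
  fixes x p :: real
  assumes "p > 0"
  shows "((\<lambda>x. \<bar>x\<bar> powr p * x) has_real_derivative (p + 1) * \<bar>x\<bar> powr p) (at x)"
proof (cases "x = 0")
  case True
  have "(\<lambda>h::real. \<bar>h\<bar> powr p) \<midarrow>0\<rightarrow> \<bar>0\<bar> powr p"
    using assms by (intro tendsto_powr2 tendsto_intros) auto
  then have "(\<lambda>h::real. \<bar>h\<bar> powr p) \<midarrow>0\<rightarrow> 0"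
    by simp
  then have "(\<lambda>h::real. \<bar>h\<bar> powr p * h / h) \<midarrow>0\<rightarrow> 0"
    by (rule Lim_transform_eventually) (auto simp: eventually_at_filter)
  then show ?thesis
    using True by (simp add: DERIV_def)
next
  case False
  have "((\<lambda>x. \<bar>x\<bar> powr p * x) has_real_derivative
      p * \<bar>x\<bar> powr (p - 1) * sgn x * x + 1 * \<bar>x\<bar> powr p) (at x)"
    using False
    by (intro DERIV_mult DERIV_ident DERIV_chain2[OF has_real_derivative_powr] DERIV_abs_nonzero) auto
  moreover have "p * \<bar>x\<bar> powr (p - 1) * sgn x * x + 1 * \<bar>x\<bar> powr p = (p + 1) * \<bar>x\<bar> powr p"
    using False by (simp add: powr_diff sgn_if field_simps)
  ultimately show ?thesis
    by simp
qed

lemma DERIV_abs_powr: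
  fixes x p :: real
  assumes "p > 1"
  shows "((\<lambda>x. \<bar>x\<bar> powr p) has_real_derivative p * \<bar>x\<bar> powr (p - 2) * x) (at x)"
proof (cases "x = 0")
  case True
  have "(\<lambda>h::real. \<bar>h\<bar> powr (p - 1)) \<midarrow>0\<rightarrow> \<bar>0\<bar> powr (p - 1)"
    using assms by (intro tendsto_powr2 tendsto_intros) auto
  then have "(\<lambda>h::real. \<bar>h\<bar> powr (p - 1)) \<midarrow>0\<rightarrow> 0"
    by simp
  \<comment> \<open>The quotient at 0 changes sign with \<open>h\<close>; only its absolute value is
    the plain power with exponent \<open>p - 1\<close>, so the limit is taken there first.\<close>
  then have "(\<lambda>h::real. \<bar>\<bar>h\<bar> powr p / h\<bar>) \<midarrow>0\<rightarrow> 0"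
    by (rule Lim_transform_eventually) (auto simp: eventually_at_filter powr_diff)
  then have "(\<lambda>h::real. \<bar>h\<bar> powr p / h) \<midarrow>0\<rightarrow> 0"
    by (rule tendsto_rabs_zero_cancel)
  then show ?thesis
    using True by (simp add: DERIV_def)
next
  case False
  have "((\<lambda>x. \<bar>x\<bar> powr p) has_real_derivative p * \<bar>x\<bar> powr (p - 1) * sgn x) (at x)"
    using False
    by (intro DERIV_chain2[OF has_real_derivative_powr] DERIV_abs_nonzero) auto
  moreover have "p * \<bar>x\<bar> powr (p - 1) * sgn x = p * \<bar>x\<bar> powr (p - 2) * x"
    using False by (simp add: powr_diff sgn_if power2_eq_square field_simps)
  ultimately show ?thesis
    by simp
qed

section \<open>Differential inequalities on the half-line\<close>

lemma Rplus_nonincreasing: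
  fixes f f' :: "real \<Rightarrow> real"
  assumes f: "\<And>t. 0 \<le> t \<Longrightarrow> t \<le> b \<Longrightarrow> (f has_real_derivative f' t) (at t within {0..})"
    and f': "\<And>t. 0 \<le> t \<Longrightarrow> t \<le> b \<Longrightarrow> f' t \<le> 0"
    and "0 \<le> a" "a \<le> b"
  shows "f b \<le> f a"
proof (rule DERIV_nonpos_imp_decreasing_open[OF \<open>a \<le> b\<close>])
  fix x assume x: "a < x" "x < b"
  \<comment> \<open>Inside the interval the derivative within the half-line is two-sided; at the
    endpoints continuity is enough.\<close>
  then have "at x within {0..} = at x"
    using \<open>0 \<le> a\<close> by (intro at_within_interior) auto
  then show "\<exists>y. (f has_real_derivative y) (at x) \<and> y \<le> 0"
    using f[of x] f'[of x] x \<open>0 \<le> a\<close> by auto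
next
  show "continuous_on {a..b} f"
    unfolding continuous_on_eq_continuous_within
  proof
    fix x assume "x \<in> {a..b}"
    then have "continuous (at x within {0..}) f"
      using f[of x] \<open>0 \<le> a\<close> by (intro DERIV_continuous) auto
    then show "continuous (at x within {a..b}) f"
      by (rule continuous_within_subset) (use \<open>0 \<le> a\<close> in auto)
  qed
qed

text \<open>While \<open>f\<close> is positive, \<open>f powr (- \<gamma>)\<close> grows at rate at
  least \<open>\<gamma> * k\<close>; integrating from 0 and inverting gives the bound. The value
  \<open>f 0\<close> drops out, so the bound is uniform over all such \<open>f\<close>.\<close>

lemma powr_decay:
  fixes f f' :: "real \<Rightarrow> real"
  assumes f: "\<And>t. 0 \<le> t \<Longrightarrow> (f has_real_derivative f' t) (at t within {0..})"
    and f': "\<And>t. 0 \<le> t \<Longrightarrow> f' t \<le> - k * f t powr (1 + \<gamma>)"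
    and nonneg: "\<And>t. 0 \<le> t \<Longrightarrow> 0 \<le> f t"
    and "k > 0" "\<gamma> > 0" "t > 0"
  shows "f t \<le> (\<gamma> * k * t) powr (- 1 / \<gamma>)"
proof (cases "f t = 0")
  case False
  \<comment> \<open>Since \<open>f\<close> is nonincreasing, a positive value at \<open>t\<close>
    forces positivity on all of [0, t], where the negative power is therefore
    differentiable.\<close>
  have pos: "f s > 0" if "0 \<le> s" "s \<le> t" for s
  proof -
    have "f t \<le> f s"
      by (rule Rplus_nonincreasing[OF f])
         (use f' that \<open>k > 0\<close> in \<open>auto intro: order_trans[OF f']\<close>)
    then show ?thesis
      using nonneg[of t] False that by simp
  qed
  define g where "g = (\<lambda>s. \<gamma> * k * s - f s powr (- \<gamma>))"
  have "g t \<le> g 0"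
  proof (rule Rplus_nonincreasing[where f = g])
    fix s assume s: "0 \<le> s" "s \<le> t"
    note [derivative_intros] = f[OF s(1)]
    show "(g has_real_derivative (\<gamma> * k - (- \<gamma>) * f s powr (- \<gamma> - 1) * f' s)) (at s within {0..})"
      unfolding g_def
      by (rule derivative_eq_intros refl pos s | simp)+
    have "f s powr (- \<gamma> - 1) * f' s \<le> f s powr (- \<gamma> - 1) * (- k * f s powr (1 + \<gamma>))"
      using f'[OF s(1)] by (intro mult_left_mono) auto
    also have "\<dots> = - k * (f s powr (- \<gamma> - 1) * f s powr (1 + \<gamma>))"
      by (simp add: algebra_simps)
    also have "\<dots> = - k"
      using pos[OF s] by (simp flip: powr_add)
    finally show "\<gamma> * k - (- \<gamma>) * f s powr (- \<gamma> - 1) * f' s \<le> 0"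
      using mult_left_mono[of "f s powr (- \<gamma> - 1) * f' s" "- k" \<gamma>] \<open>\<gamma> > 0\<close>
      by (simp add: algebra_simps)
  qed (use \<open>t > 0\<close> in auto)
  then have "\<gamma> * k * t \<le> f t powr (- \<gamma>)"
    unfolding g_def by (smt (verit) mult_zero_right powr_ge_zero)
  then have "(f t powr (- \<gamma>)) powr (- 1 / \<gamma>) \<le> (\<gamma> * k * t) powr (- 1 / \<gamma>)"
    using assms by (intro powr_mono2') auto
  then show ?thesis
    using pos[of t] \<open>t > 0\<close> \<open>\<gamma> > 0\<close> by (simp add: powr_powr)
qed simp

text \<open>Mirror image of \<open>powr_decay\<close>: \<open>f powr (- \<gamma>)\<close> now grows
  at rate at most \<open>\<gamma> * k\<close>, and its initial value has to be kept.\<close>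

lemma powr_decay_lower:
  fixes f f' :: "real \<Rightarrow> real"
  assumes f: "\<And>t. 0 \<le> t \<Longrightarrow> (f has_real_derivative f' t) (at t within {0..})"
    and f': "\<And>t. 0 \<le> t \<Longrightarrow> - k * f t powr (1 + \<gamma>) \<le> f' t"
    and bound: "\<And>t. 0 \<le> t \<Longrightarrow> 0 \<le> f t \<and> f t \<le> f 0"
    and "f 0 > 0" "k > 0" "\<gamma> > 0" "t \<ge> 0"
  shows "(f 0 powr (- \<gamma>) + \<gamma> * k * t) powr (- 1 / \<gamma>) \<le> f t"
proof -
  have pos: "f s > 0" if "0 \<le> s" for s
  proof -
    \<comment> \<open>Positivity is a Gronwall argument: \<open>f \<le> f 0\<close> yields the
      linear inequality f' \<ge> - L f, so \<open>f s * exp (L * s)\<close> is nondecreasing and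
      stays above \<open>f 0\<close>.\<close>
    define L where "L = k * f 0 powr \<gamma>"
    define h where "h = (\<lambda>s. - (f s * exp (L * s)))"
    have "h s \<le> h 0"
    proof (rule Rplus_nonincreasing[where f = h])
      fix r assume r: "0 \<le> r" "r \<le> s"
      note [derivative_intros] = f[OF r(1)]
      show "(h has_real_derivative - (f' r + L * f r) * exp (L * r)) (at r within {0..})"
        unfolding h_def by (rule derivative_eq_intros refl)+ (simp add: algebra_simps)
      have "k * f r powr (1 + \<gamma>) = k * (f r powr \<gamma> * f r)"
        using bound[OF r(1)] by (simp add: powr_add)
      also have "\<dots> \<le> k * (f 0 powr \<gamma> * f r)"
        using bound[OF r(1)] \<open>k > 0\<close> \<open>\<gamma> > 0\<close>
        by (intro mult_left_mono mult_right_mono powr_mono2) auto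
      finally have "0 \<le> f' r + L * f r"
        using f'[OF r(1)] by (simp add: L_def)
      then show "- (f' r + L * f r) * exp (L * r) \<le> 0"
        by (intro mult_nonpos_nonneg) auto
    qed (use that in auto)
    then have "f s * exp (L * s) > 0"
      using \<open>f 0 > 0\<close> by (simp add: h_def)
    then show ?thesis
      by (simp add: zero_less_mult_iff)
  qed
  define g where "g = (\<lambda>s. f s powr (- \<gamma>) - \<gamma> * k * s)"
  have "g t \<le> g 0"
  proof (rule Rplus_nonincreasing[where f = g])
    fix s assume s: "0 \<le> s" "s \<le> t"
    note [derivative_intros] = f[OF s(1)]
    show "(g has_real_derivative ((- \<gamma>) * f s powr (- \<gamma> - 1) * f' s - \<gamma> * k)) (at s within {0..})"
      unfolding g_def
      by (rule derivative_eq_intros refl pos s | simp)+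
    have "- k = - k * (f s powr (- \<gamma> - 1) * f s powr (1 + \<gamma>))"
      using pos[OF s(1)] by (simp flip: powr_add)
    also have "\<dots> = f s powr (- \<gamma> - 1) * (- k * f s powr (1 + \<gamma>))"
      by (simp add: algebra_simps)
    also have "\<dots> \<le> f s powr (- \<gamma> - 1) * f' s"
      using f'[OF s(1)] by (intro mult_left_mono) auto
    finally have "\<gamma> * (- k) \<le> \<gamma> * (f s powr (- \<gamma> - 1) * f' s)"
      using \<open>\<gamma> > 0\<close> by (intro mult_left_mono) auto
    then show "(- \<gamma>) * f s powr (- \<gamma> - 1) * f' s - \<gamma> * k \<le> 0"
      by (simp add: algebra_simps)
  qed (use \<open>t \<ge> 0\<close> in auto)
  then have "f t powr (- \<gamma>) \<le> f 0 powr (- \<gamma>) + \<gamma> * k * t"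
    unfolding g_def by simp
  then have "(f 0 powr (- \<gamma>) + \<gamma> * k * t) powr (- 1 / \<gamma>) \<le> (f t powr (- \<gamma>)) powr (- 1 / \<gamma>)"
    using \<open>\<gamma> > 0\<close> pos[OF \<open>t \<ge> 0\<close>] by (intro powr_mono2') auto
  then show ?thesis
    using pos[OF \<open>t \<ge> 0\<close>] \<open>\<gamma> > 0\<close> by (simp add: powr_powr)
qed

section \<open>Derivatives of the energy and of the multiplier along a solution\<close>

lemma C1_Rplus_has_real_derivative:
  assumes "C1_Rplus f" "0 \<le> t"
  shows "(f has_real_derivative deriv_Rplus f t) (at t within {0..})"
proof -
  have "f differentiable (at t within {0..})"
    using assms by (simp add: C1_Rplus_def differentiable_on_def)
  then show ?thesis
    unfolding deriv_Rplus_def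
    by (simp add: has_real_derivative_iff_has_vector_derivative flip: vector_derivative_works)
qed

lemma solution_has_real_derivative:
  assumes sol: "is_solution \<alpha> \<beta> c d l u" and t: "0 \<le> t"
  shows "(u has_real_derivative deriv_Rplus u t) (at t within {0..})"
    and "((\<lambda>s. \<bar>deriv_Rplus u s\<bar> powr l * deriv_Rplus u s) has_real_derivative
        - c * \<bar>deriv_Rplus u t\<bar> powr \<alpha> * deriv_Rplus u t - d * \<bar>u t\<bar> powr \<beta> * u t)
      (at t within {0..})"
proof -
  show "(u has_real_derivative deriv_Rplus u t) (at t within {0..})"
    using sol t unfolding is_solution_def by (blast intro: C1_Rplus_has_real_derivative)
  define w where "w = (\<lambda>s. \<bar>deriv_Rplus u s\<bar> powr l * deriv_Rplus u s)"
  have "(w has_real_derivative deriv_Rplus w t) (at t within {0..})"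
    using sol t unfolding is_solution_def w_def by (blast intro: C1_Rplus_has_real_derivative)
  moreover have "deriv_Rplus w t =
      - c * \<bar>deriv_Rplus u t\<bar> powr \<alpha> * deriv_Rplus u t - d * \<bar>u t\<bar> powr \<beta> * u t"
    using sol t unfolding is_solution_def w_def by (auto simp: algebra_simps eq_neg_iff_add_eq_0)
  ultimately show "(w has_real_derivative
        - c * \<bar>deriv_Rplus u t\<bar> powr \<alpha> * deriv_Rplus u t - d * \<bar>u t\<bar> powr \<beta> * u t)
      (at t within {0..})"
    by simp
qed

text \<open>For l > 0 the function u' need not be differentiable where it vanishes. The kinetic term
  is therefore written as a power of w = |u'|^l u', whose derivative the equation supplies.\<close>

lemma energy_has_real_derivative:
  fixes \<alpha> \<beta> c d l :: real
  assumes sol: "is_solution \<alpha> \<beta> c d l u" and par: "\<beta> > 0" "l \<ge> 0" and t: "0 \<le> t"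
  shows "(energy \<beta> d l u has_real_derivative - c * \<bar>deriv_Rplus u t\<bar> powr (\<alpha> + 2))
    (at t within {0..})"
proof -
  define v where "v = deriv_Rplus u"
  define w where "w = (\<lambda>s. \<bar>v s\<bar> powr l * v s)"
  \<comment> \<open>As |w| is |u'| to the power l + 1, this exponent recovers the power l + 2. It
    exceeds 1, so \<open>DERIV_abs_powr\<close> applies also at zeros of u'.\<close>
  define p where "p = (l + 2) / (l + 1)"
  have p: "p > 1" "(l + 1) * p = l + 2" "(l + 1) * (p - 2) = - l" "(l + 1) / (l + 2) * p = 1"
    using par by (auto simp: p_def field_simps add_nonneg_eq_0_iff)
  have absw: "\<bar>w s\<bar> = \<bar>v s\<bar> powr (l + 1)" for s
    by (simp add: w_def abs_mult powr_add)
  note u' = solution_has_real_derivative(1)[OF sol t, folded v_def]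
  note w' = solution_has_real_derivative(2)[OF sol t, folded v_def, folded w_def]
  have en: "energy \<beta> d l u = (\<lambda>s. (l + 1) / (l + 2) * \<bar>w s\<bar> powr p + d / (\<beta> + 2) * \<bar>u s\<bar> powr (\<beta> + 2))"
    by (simp add: energy_def fun_eq_iff absw powr_powr p flip: v_def)
  \<comment> \<open>The map in \<open>w\<close> coming from the chain rule inverts v -> |v|^l
    v.\<close>
  have v: "\<bar>w t\<bar> powr (p - 2) * w t = v t"
  proof (cases "v t = 0")
    case False
    have "\<bar>w t\<bar> powr (p - 2) = \<bar>v t\<bar> powr (- l)"
      by (simp add: absw powr_powr p)
    then show ?thesis
      using False by (simp add: w_def powr_minus)
  qed (simp add: w_def)
  have sq: "\<bar>v t\<bar> powr (\<alpha> + 2) = \<bar>v t\<bar> powr \<alpha> * v t * v t"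
    by (cases "v t = 0") (simp_all add: powr_add power2_eq_square)
  have D: "(energy \<beta> d l u has_real_derivative
     (l + 1) / (l + 2) * (p * \<bar>w t\<bar> powr (p - 2) * w t *
        (- c * \<bar>v t\<bar> powr \<alpha> * v t - d * \<bar>u t\<bar> powr \<beta> * u t))
     + d / (\<beta> + 2) * ((\<beta> + 2) * \<bar>u t\<bar> powr (\<beta> + 2 - 2) * u t * v t)) (at t within {0..})"
    unfolding en using p par
    by (intro DERIV_add DERIV_cmult DERIV_chain2[OF DERIV_abs_powr] w' u') auto
  have "(l + 1) / (l + 2) * (p * \<bar>w t\<bar> powr (p - 2) * w t *
        (- c * \<bar>v t\<bar> powr \<alpha> * v t - d * \<bar>u t\<bar> powr \<beta> * u t))
     + d / (\<beta> + 2) * ((\<beta> + 2) * \<bar>u t\<bar> powr (\<beta> + 2 - 2) * u t * v t)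
     = ((l + 1) / (l + 2) * p) * (\<bar>w t\<bar> powr (p - 2) * w t) *
        (- c * \<bar>v t\<bar> powr \<alpha> * v t - d * \<bar>u t\<bar> powr \<beta> * u t)
     + d / (\<beta> + 2) * (\<beta> + 2) * \<bar>u t\<bar> powr \<beta> * u t * v t"
    by (simp only: mult.assoc add_diff_cancel_right')
  \<comment> \<open>The restoring term of the equation cancels the derivative of the potential
    energy; only the damping survives.\<close>
  also have "\<dots> = - c * \<bar>v t\<bar> powr (\<alpha> + 2)"
  proof -
    have "d / (\<beta> + 2) * (\<beta> + 2) = d"
      using par by simp
    then show ?thesis
      unfolding v p sq by (simp only: mult_1_left) (simp add: algebra_simps)
  qed
  finally show ?thesis
    using D unfolding v_def by metis
qed

text \<open>Product rule for |u|^\<theta> u and |u'|^l u'. Inserting the equation for the second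
  factor makes the restoring force produce the negative power of |u|, and the damping the mixed term
  of unknown sign.\<close>

lemma multiplier_has_real_derivative:
  fixes \<alpha> \<beta> c d l \<theta> :: real
  assumes sol: "is_solution \<alpha> \<beta> c d l u" and "\<theta> > 0" and t: "0 \<le> t"
  shows "((\<lambda>s. \<bar>u s\<bar> powr \<theta> * u s * (\<bar>deriv_Rplus u s\<bar> powr l * deriv_Rplus u s))
    has_real_derivative
     (\<theta> + 1) * \<bar>u t\<bar> powr \<theta> * \<bar>deriv_Rplus u t\<bar> powr (l + 2)
     - c * (\<bar>u t\<bar> powr \<theta> * u t * (\<bar>deriv_Rplus u t\<bar> powr \<alpha> * deriv_Rplus u t))
     - d * \<bar>u t\<bar> powr (\<theta> + \<beta> + 2)) (at t within {0..})"
proof -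
  define v where "v = deriv_Rplus u"
  define w where "w = (\<lambda>s. \<bar>v s\<bar> powr l * v s)"
  note u' = solution_has_real_derivative(1)[OF sol t, folded v_def]
  note w' = solution_has_real_derivative(2)[OF sol t, folded v_def, folded w_def]
  have sqv: "\<bar>v t\<bar> powr (l + 2) = \<bar>v t\<bar> powr l * v t * v t"
    by (cases "v t = 0") (simp_all add: powr_add power2_eq_square)
  have squ: "\<bar>u t\<bar> powr (\<theta> + \<beta> + 2) = \<bar>u t\<bar> powr \<theta> * \<bar>u t\<bar> powr \<beta> * u t * u t"
    by (cases "u t = 0") (simp_all add: powr_add power2_eq_square)
  have "((\<lambda>s. \<bar>u s\<bar> powr \<theta> * u s * w s) has_real_derivative
     ((\<theta> + 1) * \<bar>u t\<bar> powr \<theta> * v t) * w t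
     + (- c * \<bar>v t\<bar> powr \<alpha> * v t - d * \<bar>u t\<bar> powr \<beta> * u t) * (\<bar>u t\<bar> powr \<theta> * u t))
     (at t within {0..})"
    by (intro DERIV_mult DERIV_chain2[OF DERIV_abs_powr_mult] w' u' assms)
  moreover have "((\<theta> + 1) * \<bar>u t\<bar> powr \<theta> * v t) * w t
     + (- c * \<bar>v t\<bar> powr \<alpha> * v t - d * \<bar>u t\<bar> powr \<beta> * u t) * (\<bar>u t\<bar> powr \<theta> * u t)
     = (\<theta> + 1) * \<bar>u t\<bar> powr \<theta> * \<bar>v t\<bar> powr (l + 2)
     - c * (\<bar>u t\<bar> powr \<theta> * u t * (\<bar>v t\<bar> powr \<alpha> * v t))
     - d * \<bar>u t\<bar> powr (\<theta> + \<beta> + 2)"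
    unfolding sqv squ w_def by (simp add: algebra_simps)
  ultimately show ?thesis
    unfolding v_def w_def by metis
qed

section \<open>Pointwise dissipation estimate for the perturbed energy\<close>

lemma le_root_bound:
  fixes a p x M :: real
  assumes "a > 0" "p > 0" "0 \<le> x" "a * x powr p \<le> M"
  shows "x \<le> (\<bar>M\<bar> / a) powr (1 / p) + 1"
proof -
  have "x = (x powr p) powr (1 / p)"
    using assms by (simp add: powr_powr)
  also have "\<dots> \<le> (\<bar>M\<bar> / a) powr (1 / p)"
    using assms by (intro powr_mono2) (auto simp: field_simps)
  finally show ?thesis by simp
qed

text \<open>
  In the application \<open>x\<close> and \<open>y\<close> are the values of the solution and of its derivative, and the left-hand
  side of the second conclusion is the derivative of the perturbed energy \<open>e + \<epsilon> * F\<close>.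
\<close>

lemma perturbed_energy_dissipation:
  fixes \<alpha> \<beta> c d l \<theta> M :: real
  assumes par: "\<alpha> > 0" "\<beta> > 0" "c > 0" "d > 0" "l \<ge> 0" "\<theta> > 0"
    and h1: "\<beta> - \<alpha> \<le> \<theta> * (\<alpha> + 1)"
    and h2: "(\<beta> + 2) * (\<alpha> - l) \<le> \<theta> * (l + 2)"
    and h3: "\<beta> + 2 \<le> (\<theta> + 1) * (l + 2)"
  obtains \<epsilon> k where "\<epsilon> > 0" "k > 0"
    "\<And>x y e F. e = (l + 1) / (l + 2) * \<bar>y\<bar> powr (l + 2) + d / (\<beta> + 2) * \<bar>x\<bar> powr (\<beta> + 2) \<Longrightarrow>
      e \<le> M \<Longrightarrow> F = \<bar>x\<bar> powr \<theta> * x * (\<bar>y\<bar> powr l * y) \<Longrightarrow>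
      e \<le> 2 * (e + \<epsilon> * F) \<and>
      - c * \<bar>y\<bar> powr (\<alpha> + 2)
        + \<epsilon> * ((\<theta> + 1) * \<bar>x\<bar> powr \<theta> * \<bar>y\<bar> powr (l + 2)
          - c * (\<bar>x\<bar> powr \<theta> * x * (\<bar>y\<bar> powr \<alpha> * y)) - d * \<bar>x\<bar> powr (\<theta> + \<beta> + 2))
      \<le> - k * (e + \<epsilon> * F) powr (1 + \<theta> / (\<beta> + 2))"
proof -
  define a where "a = (l + 1) / (l + 2)"
  define b where "b = d / (\<beta> + 2)"
  \<comment> \<open>With this exponent, \<bar>x\<bar> powr (\<beta> + 2) raised to \<open>g\<close>
    is exactly the dissipated power \<theta> + \<beta> + 2, while \<open>h2\<close> says that
    \<open>(l + 2) * g\<close> is at least \<alpha> + 2.\<close>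
  define g where "g = 1 + \<theta> / (\<beta> + 2)"
  \<comment> \<open>\<open>R\<close> and \<open>S\<close> bound \<bar>x\<bar> and \<bar>y\<bar> when
    the energy is at most \<open>M\<close>; the summand 1 keeps them positive whatever
    \<open>M\<close> is.\<close>
  define R where "R = (\<bar>M\<bar> / b) powr (1 / (\<beta> + 2)) + 1"
  define S where "S = (\<bar>M\<bar> / a) powr (1 / (l + 2)) + 1"
  \<comment> \<open>Chosen so that y^(l+1) = x^p exactly when y^(l+2) = x^(\<beta>+2), the scale at
    which kinetic and potential energy balance.\<close>
  define p where "p = (\<beta> + 2) * (l + 1) / (l + 2)"
  have ab: "a > 0" "b > 0"
    using par by (simp_all add: a_def b_def)
  have RS: "R > 0" "S > 0"
    unfolding R_def S_def by (simp_all add: add_nonneg_pos)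
  have g: "g > 0" "(\<beta> + 2) * g = \<theta> + \<beta> + 2" "\<alpha> + 2 \<le> (l + 2) * g"
    using par h2 by (auto simp: g_def field_simps add_pos_pos)
  have p: "p > 0" "\<beta> + 2 \<le> \<theta> + 1 + p" "l + 2 \<le> l + 1 + (l + 1) * (\<theta> + 1) / p"
  proof -
    show "p > 0"
      using par by (simp add: p_def)
    have "(\<beta> + 2) / (l + 2) \<le> \<theta> + 1"
      using par h3 by (simp add: field_simps)
    moreover have "\<beta> + 2 = (\<beta> + 2) / (l + 2) + p"
      using par by (simp add: p_def add_divide_distrib[symmetric] distrib_left[symmetric]
          nonzero_eq_divide_eq algebra_simps)
    ultimately show "\<beta> + 2 \<le> \<theta> + 1 + p" by linarith
    have "(l + 1) * (\<theta> + 1) / p = (\<theta> + 1) * (l + 2) / (\<beta> + 2)"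
      using par by (simp add: p_def)
    also have "1 \<le> \<dots>"
      using par h3 by simp
    finally show "l + 2 \<le> l + 1 + (l + 1) * (\<theta> + 1) / p" by simp
  qed
  \<comment> \<open>\<open>h2\<close> is the exponent condition for \<open>K1\<close>,
    \<open>h1\<close> the one for \<open>K2\<close>. Each weight is set so that its error term
    consumes a quarter of \<open>d\<close>.\<close>
  obtain K1 where K1: "K1 > 0" "\<And>x y. 0 \<le> x \<Longrightarrow> 0 \<le> y \<Longrightarrow> y \<le> S \<Longrightarrow>
      x powr \<theta> * y powr (l + 2) \<le> d / (4 * (\<theta> + 1)) * x powr (\<theta> + (\<beta> + 2)) + K1 * y powr (\<alpha> + 2)"
    by (rule powr_mult_split[of "\<beta> + 2" \<theta> "d / (4 * (\<theta> + 1))" S "\<alpha> + 2" "l + 2"])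
       (use par RS g in \<open>auto simp: g_def algebra_simps\<close>)
  have "\<alpha> + 2 \<le> \<alpha> + 1 + (\<alpha> + 1) * (\<theta> + 1) / (\<beta> + 1)"
    using par h1 by (simp add: field_simps)
  then obtain K2 where K2: "K2 > 0" "\<And>x y. 0 \<le> x \<Longrightarrow> 0 \<le> y \<Longrightarrow> y \<le> S \<Longrightarrow>
      x powr (\<theta> + 1) * y powr (\<alpha> + 1) \<le> d / (4 * c) * x powr (\<theta> + 1 + (\<beta> + 1)) + K2 * y powr (\<alpha> + 2)"
    using powr_mult_split[of "\<beta> + 1" "\<theta> + 1" "d / (4 * c)" S "\<alpha> + 2" "\<alpha> + 1"] par RS by auto
  \<comment> \<open>This split, which rests on \<open>h3\<close>, serves to bound \<open>F\<close>
    by a multiple of the energy.\<close>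
  obtain K3 where K3: "K3 > 0" "\<And>x y. 0 \<le> x \<Longrightarrow> 0 \<le> y \<Longrightarrow> y \<le> S \<Longrightarrow>
      x powr (\<theta> + 1) * y powr (l + 1) \<le> 1 * x powr (\<theta> + 1 + p) + K3 * y powr (l + 2)"
    using powr_mult_split[of p "\<theta> + 1" 1 S "l + 2" "l + 1"] par RS p by auto
  \<comment> \<open>\<open>L\<close> will give \<bar>F\<bar> \<le> L e, and \<open>K\<close>
    collects the errors in \<bar>y\<bar> powr (\<alpha> + 2). The two bounds in
    \<open>\<epsilon>\<close> ensure \<bar>\<epsilon> F\<bar> \<le> e / 2 and that at most half of
    the damping is spent.\<close>
  define L where "L = R powr (\<theta> + 1 + p - (\<beta> + 2)) / b + K3 / a"
  define K where "K = (\<theta> + 1) * K1 + c * K2"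
  define \<epsilon> where "\<epsilon> = min (1 / (2 * L)) (c / (2 * K))"
  define k0 where "k0 = min (c / 2) (\<epsilon> * d / 2)"
  define N where "N = 2 powr g * (a powr g * S powr ((l + 2) * g - (\<alpha> + 2)) + b powr g)"
  define k where "k = k0 / (2 powr g * N)"
  have "L > 0"
    using ab K3 by (simp add: L_def add_nonneg_pos)
  have "K > 0"
    using par K1 K2 by (simp add: K_def add_pos_pos)
  have \<epsilon>: "\<epsilon> > 0" "\<epsilon> * L \<le> 1 / 2" "\<epsilon> * K \<le> c / 2"
  proof -
    show "\<epsilon> > 0"
      using \<open>L > 0\<close> \<open>K > 0\<close> par by (simp add: \<epsilon>_def)
    have "\<epsilon> \<le> 1 / (2 * L)" "\<epsilon> \<le> c / (2 * K)"
      by (simp_all add: \<epsilon>_def)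
    then show "\<epsilon> * L \<le> 1 / 2" "\<epsilon> * K \<le> c / 2"
      using \<open>L > 0\<close> \<open>K > 0\<close> by (simp_all add: field_simps)
  qed
  have k0: "k0 > 0" "k0 \<le> c / 2" "k0 \<le> \<epsilon> * d / 2"
    using par \<epsilon> by (simp_all add: k0_def)
  have "N > 0"
    using ab by (simp add: N_def add_nonneg_pos)
  have "k > 0"
    using k0 \<open>N > 0\<close> by (simp add: k_def)
  show thesis
  proof (rule that[OF \<open>\<epsilon> > 0\<close> \<open>k > 0\<close>])
    fix x y e F :: real
    assume "e = (l + 1) / (l + 2) * \<bar>y\<bar> powr (l + 2) + d / (\<beta> + 2) * \<bar>x\<bar> powr (\<beta> + 2)"
    then have e: "e = a * \<bar>y\<bar> powr (l + 2) + b * \<bar>x\<bar> powr (\<beta> + 2)"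
      by (simp add: a_def b_def)
    assume "e \<le> M"
    assume F: "F = \<bar>x\<bar> powr \<theta> * x * (\<bar>y\<bar> powr l * y)"
    have ae: "a * \<bar>y\<bar> powr (l + 2) \<le> e" and be: "b * \<bar>x\<bar> powr (\<beta> + 2) \<le> e"
      using ab by (simp_all add: e)
    have x: "\<bar>x\<bar> \<le> R"
      unfolding R_def using ab par be \<open>e \<le> M\<close> by (intro le_root_bound) auto
    have y: "\<bar>y\<bar> \<le> S"
      unfolding S_def using ab par ae \<open>e \<le> M\<close> by (intro le_root_bound) auto
    have "\<bar>F\<bar> = \<bar>x\<bar> powr (\<theta> + 1) * \<bar>y\<bar> powr (l + 1)"
      by (simp add: F abs_mult powr_add)
    also have "\<dots> \<le> \<bar>x\<bar> powr (\<theta> + 1 + p) + K3 * \<bar>y\<bar> powr (l + 2)"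
      using K3(2)[of "\<bar>x\<bar>" "\<bar>y\<bar>"] y by simp
    also have "\<dots> \<le> R powr (\<theta> + 1 + p - (\<beta> + 2)) * \<bar>x\<bar> powr (\<beta> + 2) + K3 * \<bar>y\<bar> powr (l + 2)"
      using powr_le_scaled[OF _ x p(2)] by simp
    also have "\<dots> = R powr (\<theta> + 1 + p - (\<beta> + 2)) / b * (b * \<bar>x\<bar> powr (\<beta> + 2))
        + K3 / a * (a * \<bar>y\<bar> powr (l + 2))"
      using ab by simp
    also have "\<dots> \<le> R powr (\<theta> + 1 + p - (\<beta> + 2)) / b * e + K3 / a * e"
      using ab K3 ae be by (intro add_mono mult_left_mono) auto
    also have "\<dots> = L * e"
      by (simp add: L_def algebra_simps)
    finally have FL: "\<bar>F\<bar> \<le> L * e" .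
    have "e \<ge> 0"
      using ab by (simp add: e)
    have "\<bar>\<epsilon> * F\<bar> \<le> \<epsilon> * (L * e)"
      using FL \<epsilon> by (simp add: abs_mult)
    also have "\<dots> \<le> 1 / 2 * e"
      using mult_right_mono[OF \<epsilon>(2) \<open>e \<ge> 0\<close>] by (simp add: mult.assoc)
    finally have \<epsilon>F: "\<bar>\<epsilon> * F\<bar> \<le> e / 2" by simp
    define P where "P = \<bar>y\<bar> powr (\<alpha> + 2)"
    define Q where "Q = \<bar>x\<bar> powr (\<theta> + \<beta> + 2)"
    have PQ: "P \<ge> 0" "Q \<ge> 0"
      by (simp_all add: P_def Q_def)
    have "\<bar>x\<bar> powr \<theta> * \<bar>y\<bar> powr (l + 2) \<le> d / (4 * (\<theta> + 1)) * Q + K1 * P"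
      using K1(2)[of "\<bar>x\<bar>" "\<bar>y\<bar>"] y by (simp add: P_def Q_def add.assoc)
    from mult_left_mono[OF this, of "\<theta> + 1"]
    have *: "(\<theta> + 1) * (\<bar>x\<bar> powr \<theta> * \<bar>y\<bar> powr (l + 2))
        \<le> (\<theta> + 1) * (d / (4 * (\<theta> + 1)) * Q + K1 * P)"
      using par by simp
    have i1: "(\<theta> + 1) * \<bar>x\<bar> powr \<theta> * \<bar>y\<bar> powr (l + 2) \<le> d / 4 * Q + (\<theta> + 1) * K1 * P"
    proof -
      have "(\<theta> + 1) * (d / (4 * (\<theta> + 1))) = d / 4"
        using par by (simp add: nonzero_divide_eq_eq)
      with * show ?thesis
        by (simp only: distrib_left[of "\<theta> + 1"] mult.assoc[symmetric])
    qed
    have "\<bar>\<bar>x\<bar> powr \<theta> * x * (\<bar>y\<bar> powr \<alpha> * y)\<bar> = \<bar>x\<bar> powr (\<theta> + 1) * \<bar>y\<bar> powr (\<alpha> + 1)"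
      by (simp add: abs_mult powr_add)
    also have "\<dots> \<le> d / (4 * c) * Q + K2 * P"
      using K2(2)[of "\<bar>x\<bar>" "\<bar>y\<bar>"] y by (simp add: P_def Q_def algebra_simps)
    finally have "- (\<bar>x\<bar> powr \<theta> * x * (\<bar>y\<bar> powr \<alpha> * y)) \<le> d / (4 * c) * Q + K2 * P"
      by linarith
    from mult_left_mono[OF this, of c]
    have *: "c * - (\<bar>x\<bar> powr \<theta> * x * (\<bar>y\<bar> powr \<alpha> * y)) \<le> c * (d / (4 * c) * Q + K2 * P)"
      using par by simp
    have i2: "- c * (\<bar>x\<bar> powr \<theta> * x * (\<bar>y\<bar> powr \<alpha> * y)) \<le> d / 4 * Q + c * K2 * P"
    proof -
      have "c * (d / (4 * c)) = d / 4"
        using par by simp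
      with * show ?thesis
        by (simp only: distrib_left[of c] mult.assoc[symmetric] mult_minus_left mult_minus_right)
    qed
    have "(\<theta> + 1) * \<bar>x\<bar> powr \<theta> * \<bar>y\<bar> powr (l + 2)
          - c * (\<bar>x\<bar> powr \<theta> * x * (\<bar>y\<bar> powr \<alpha> * y)) - d * Q \<le> K * P - d / 2 * Q"
      using i1 i2 by (simp add: K_def algebra_simps)
    from mult_left_mono[OF this, of \<epsilon>]
    have "- c * P + \<epsilon> * ((\<theta> + 1) * \<bar>x\<bar> powr \<theta> * \<bar>y\<bar> powr (l + 2)
          - c * (\<bar>x\<bar> powr \<theta> * x * (\<bar>y\<bar> powr \<alpha> * y)) - d * Q)
        \<le> - c * P + (\<epsilon> * K) * P - \<epsilon> * d / 2 * Q"
      using \<epsilon> by (simp add: algebra_simps)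
    also have "\<dots> \<le> - c * P + c / 2 * P - \<epsilon> * d / 2 * Q"
      using mult_right_mono[OF \<epsilon>(3) PQ(1)] by linarith
    also have "\<dots> \<le> - k0 * (P + Q)"
      using mult_right_mono[OF k0(2) PQ(1)] mult_right_mono[OF k0(3) PQ(2)]
      by (simp add: algebra_simps)
    finally have D: "- c * P + \<epsilon> * ((\<theta> + 1) * \<bar>x\<bar> powr \<theta> * \<bar>y\<bar> powr (l + 2)
          - c * (\<bar>x\<bar> powr \<theta> * x * (\<bar>y\<bar> powr \<alpha> * y)) - d * Q) \<le> - k0 * (P + Q)" .
    \<comment> \<open>It remains to compare with the dissipation \<open>P + Q\<close>: the potential
      part matches \<open>Q\<close> exactly, and the kinetic exponent is lowered to \<alpha> + 2 at
      the cost of a power of \<open>S\<close>.\<close>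
    have "e powr g \<le> 2 powr g * ((a * \<bar>y\<bar> powr (l + 2)) powr g + (b * \<bar>x\<bar> powr (\<beta> + 2)) powr g)"
      unfolding e using ab g by (intro powr_add_le) auto
    also have "\<dots> = 2 powr g * (a powr g * \<bar>y\<bar> powr ((l + 2) * g) + b powr g * Q)"
      using ab by (simp add: powr_mult powr_powr g Q_def)
    also have "\<dots> \<le> 2 powr g * (a powr g * (S powr ((l + 2) * g - (\<alpha> + 2)) * P) + b powr g * Q)"
      unfolding P_def using y g
      by (intro mult_left_mono add_mono powr_le_scaled order_refl) auto
    also have "\<dots> \<le> N * (P + Q)"
      using PQ by (simp add: N_def algebra_simps add_increasing add_increasing2)
    finally have eN: "e powr g \<le> N * (P + Q)" .
    have "(e + \<epsilon> * F) powr g \<le> (2 * e) powr g"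
      using \<epsilon>F g by (intro powr_mono2) (auto simp: abs_if split: if_splits)
    also have "\<dots> = 2 powr g * e powr g"
      using \<open>e \<ge> 0\<close> by (simp add: powr_mult)
    also have "\<dots> \<le> 2 powr g * (N * (P + Q))"
      using eN by simp
    finally have "k * (e + \<epsilon> * F) powr g \<le> k * (2 powr g * (N * (P + Q)))"
      using \<open>k > 0\<close> by simp
    also have "\<dots> = k0 * (P + Q)"
      using \<open>N > 0\<close> by (simp add: k_def)
    finally have "- k0 * (P + Q) \<le> - k * (e + \<epsilon> * F) powr g"
      by simp
    with D \<epsilon>F show "e \<le> 2 * (e + \<epsilon> * F) \<and>
      - c * \<bar>y\<bar> powr (\<alpha> + 2)
        + \<epsilon> * ((\<theta> + 1) * \<bar>x\<bar> powr \<theta> * \<bar>y\<bar> powr (l + 2)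
          - c * (\<bar>x\<bar> powr \<theta> * x * (\<bar>y\<bar> powr \<alpha> * y)) - d * \<bar>x\<bar> powr (\<theta> + \<beta> + 2))
      \<le> - k * (e + \<epsilon> * F) powr (1 + \<theta> / (\<beta> + 2))"
      by (auto simp flip: P_def Q_def g_def simp: abs_le_iff)
  qed
qed

section \<open>Energy bounds for solutions\<close>

context
  fixes \<alpha> \<beta> c d l :: real
  assumes par: "\<alpha> > 0" "\<beta> > 0" "c > 0" "d > 0" "l \<ge> 0" "\<alpha> > l"
begin

lemma energy_nonneg: "0 \<le> energy \<beta> d l u t"
  using par by (simp add: energy_def)

lemma energy_le_initial:
  assumes "is_solution \<alpha> \<beta> c d l u" "0 \<le> t"
  shows "energy \<beta> d l u t \<le> energy \<beta> d l u 0"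
proof (rule Rplus_nonincreasing[where f = "energy \<beta> d l u"])
  show "(energy \<beta> d l u has_real_derivative - c * \<bar>deriv_Rplus u s\<bar> powr (\<alpha> + 2)) (at s within {0..})"
    if "0 \<le> s" for s
    using energy_has_real_derivative[OF assms(1)] par that by blast
qed (use par assms in auto)

lemma energy_upper:
  assumes "\<theta> > 0" "\<beta> - \<alpha> \<le> \<theta> * (\<alpha> + 1)" "(\<beta> + 2) * (\<alpha> - l) \<le> \<theta> * (l + 2)"
    "\<beta> + 2 \<le> (\<theta> + 1) * (l + 2)"
  shows "\<exists>C :: real \<Rightarrow> real. \<forall>u. is_solution \<alpha> \<beta> c d l u \<longrightarrow>
    (\<forall>t\<ge>1. energy \<beta> d l u t \<le> C (energy \<beta> d l u 0) * t powr (- ((\<beta> + 2) / \<theta>)))"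
proof -
  define g where "g = \<theta> / (\<beta> + 2)"
  have "g > 0"
    using par assms by (simp add: g_def)
  \<comment> \<open>The initial energy \<open>M\<close> is fixed before \<open>u\<close>, because
    \<open>\<epsilon>\<close> and \<open>k\<close> depend on it; choosing a constant for each
    \<open>M\<close> then gives the function \<open>C\<close>.\<close>
  have "\<exists>C. \<forall>u. is_solution \<alpha> \<beta> c d l u \<longrightarrow> energy \<beta> d l u 0 = M \<longrightarrow>
    (\<forall>t\<ge>1. energy \<beta> d l u t \<le> C * t powr (- ((\<beta> + 2) / \<theta>)))" for M
  proof -
    from perturbed_energy_dissipation[OF par(1-5) assms, of M] obtain \<epsilon> k where
      \<epsilon>k: "\<epsilon> > 0" "k > 0" and
      *: "\<And>x y e F. e = (l + 1) / (l + 2) * \<bar>y\<bar> powr (l + 2) + d / (\<beta> + 2) * \<bar>x\<bar> powr (\<beta> + 2) \<Longrightarrow>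
        e \<le> M \<Longrightarrow> F = \<bar>x\<bar> powr \<theta> * x * (\<bar>y\<bar> powr l * y) \<Longrightarrow>
        e \<le> 2 * (e + \<epsilon> * F) \<and>
        - c * \<bar>y\<bar> powr (\<alpha> + 2)
          + \<epsilon> * ((\<theta> + 1) * \<bar>x\<bar> powr \<theta> * \<bar>y\<bar> powr (l + 2)
            - c * (\<bar>x\<bar> powr \<theta> * x * (\<bar>y\<bar> powr \<alpha> * y)) - d * \<bar>x\<bar> powr (\<theta> + \<beta> + 2))
        \<le> - k * (e + \<epsilon> * F) powr (1 + \<theta> / (\<beta> + 2))"
      by blast
    have "energy \<beta> d l u t \<le> 2 * (g * k) powr (- 1 / g) * t powr (- ((\<beta> + 2) / \<theta>))"
      if sol: "is_solution \<alpha> \<beta> c d l u" and M: "energy \<beta> d l u 0 = M" and "t \<ge> 1" for u t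
    proof -
      define F where "F = (\<lambda>s. \<bar>u s\<bar> powr \<theta> * u s * (\<bar>deriv_Rplus u s\<bar> powr l * deriv_Rplus u s))"
      define H where "H = (\<lambda>s. energy \<beta> d l u s + \<epsilon> * F s)"
      define H' where "H' = (\<lambda>s. - c * \<bar>deriv_Rplus u s\<bar> powr (\<alpha> + 2)
        + \<epsilon> * ((\<theta> + 1) * \<bar>u s\<bar> powr \<theta> * \<bar>deriv_Rplus u s\<bar> powr (l + 2)
          - c * (\<bar>u s\<bar> powr \<theta> * u s * (\<bar>deriv_Rplus u s\<bar> powr \<alpha> * deriv_Rplus u s))
          - d * \<bar>u s\<bar> powr (\<theta> + \<beta> + 2)))"
      have H: "energy \<beta> d l u s \<le> 2 * H s" "H' s \<le> - k * H s powr (1 + g)" if "0 \<le> s" for s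
        using *[OF energy_def, of u s "F s"] energy_le_initial[OF sol that]
        by (simp_all add: M F_def H_def H'_def g_def)
      have "H t \<le> (g * k * t) powr (- 1 / g)"
      proof (rule powr_decay)
        show "(H has_real_derivative H' s) (at s within {0..})" if "0 \<le> s" for s
          unfolding H_def H'_def F_def
          using par assms that sol
          by (intro DERIV_add DERIV_cmult energy_has_real_derivative multiplier_has_real_derivative)
        show "0 \<le> H s" if "0 \<le> s" for s
          using H(1)[OF that] energy_nonneg[of u s] by linarith
      qed (use H \<epsilon>k \<open>g > 0\<close> \<open>t \<ge> 1\<close> in auto)
      also have "\<dots> = (g * k) powr (- 1 / g) * t powr (- 1 / g)"
        using \<open>g > 0\<close> \<epsilon>k \<open>t \<ge> 1\<close> by (simp add: powr_mult)
      also have "t powr (- 1 / g) = t powr (- ((\<beta> + 2) / \<theta>))"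
        by (simp add: g_def minus_divide_left)
      finally show ?thesis
        using H(1)[of t] \<open>t \<ge> 1\<close> by simp
    qed
    then show ?thesis by blast
  qed
  then obtain C where "\<forall>M u. is_solution \<alpha> \<beta> c d l u \<longrightarrow> energy \<beta> d l u 0 = M \<longrightarrow>
    (\<forall>t\<ge>1. energy \<beta> d l u t \<le> C M * t powr (- ((\<beta> + 2) / \<theta>)))"
    by metis
  then show ?thesis by blast
qed

text \<open>The bound from \<open>powr_decay_lower\<close> involves the initial energy only through
  an additive constant, which the linear term dominates for large t; hence \<eta> is the same for
  all u.\<close>

lemma energy_lower:
  "\<exists>\<eta>>0. \<forall>u. is_solution \<alpha> \<beta> c d l u \<longrightarrow> energy \<beta> d l u 0 \<noteq> 0 \<longrightarrow>
    Liminf at_top (\<lambda>t. ereal (t powr ((l + 2) / (\<alpha> - l)) * energy \<beta> d l u t)) \<ge> ereal \<eta>"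
proof -
  define g where "g = (\<alpha> - l) / (l + 2)"
  \<comment> \<open>\<open>A\<close> bounds |u'|^(l+2) by a multiple of the energy; raising this to
    the power \<open>1 + g\<close> yields the power \<alpha> + 2 in the dissipation.\<close>
  define A where "A = (l + 2) / (l + 1)"
  define k where "k = c * A powr (1 + g)"
  have g: "g > 0" "(l + 2) * (1 + g) = \<alpha> + 2" "(l + 2) / (\<alpha> - l) = 1 / g"
    using par by (simp_all add: g_def field_simps)
  have "A > 0"
    using par by (simp add: A_def)
  then have "k > 0"
    using par by (simp add: k_def)
  \<comment> \<open>The factor 2 absorbs the initial term, which is at most \<open>g * k * t\<close>
    once t passes the threshold \<open>T\<close> below.\<close>
  define \<eta> where "\<eta> = (2 * g * k) powr (- 1 / g)"
  have "\<eta> > 0"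
    using g \<open>k > 0\<close> by (simp add: \<eta>_def)
  moreover have "ereal \<eta> \<le> Liminf at_top (\<lambda>t. ereal (t powr (1 / g) * energy \<beta> d l u t))"
    if sol: "is_solution \<alpha> \<beta> c d l u" and "energy \<beta> d l u 0 \<noteq> 0" for u
  proof (rule Liminf_bounded)
    define f where "f = energy \<beta> d l u"
    have "f 0 > 0"
      using that energy_nonneg[of u 0] by (simp add: f_def)
    have low: "(f 0 powr (- g) + g * k * t) powr (- 1 / g) \<le> f t" if "0 \<le> t" for t
    proof (rule powr_decay_lower)
      fix s :: real
      assume s: "0 \<le> s"
      show "(f has_real_derivative - c * \<bar>deriv_Rplus u s\<bar> powr (\<alpha> + 2)) (at s within {0..})"
        unfolding f_def using par by (intro energy_has_real_derivative sol s)
      have "(l + 1) / (l + 2) * \<bar>deriv_Rplus u s\<bar> powr (l + 2) \<le> f s"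
        using par by (simp add: f_def energy_def)
      then have "\<bar>deriv_Rplus u s\<bar> powr (l + 2) \<le> A * f s"
        using par by (simp add: A_def field_simps)
      then have "(\<bar>deriv_Rplus u s\<bar> powr (l + 2)) powr (1 + g) \<le> (A * f s) powr (1 + g)"
        using g by (intro powr_mono2) auto
      then have "\<bar>deriv_Rplus u s\<bar> powr (\<alpha> + 2) \<le> A powr (1 + g) * f s powr (1 + g)"
        using \<open>A > 0\<close> energy_nonneg[of u s] by (simp add: powr_powr g powr_mult f_def)
      from mult_left_mono[OF this, of c]
      show "- k * f s powr (1 + g) \<le> - c * \<bar>deriv_Rplus u s\<bar> powr (\<alpha> + 2)"
        using par by (simp add: k_def mult.assoc)
      show "0 \<le> f s \<and> f s \<le> f 0"
        using energy_nonneg energy_le_initial[OF sol s] by (simp add: f_def)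
    qed (use \<open>f 0 > 0\<close> \<open>k > 0\<close> g that in auto)
    define T where "T = f 0 powr (- g) / (g * k)"
    have "eventually (\<lambda>t. t \<ge> max 1 T) at_top"
      by (rule eventually_ge_at_top)
    then show "\<forall>\<^sub>F t in at_top. ereal \<eta> \<le> ereal (t powr (1 / g) * energy \<beta> d l u t)"
    proof eventually_elim
      case (elim t)
      have "f 0 powr (- g) \<le> g * k * t"
        using elim g \<open>k > 0\<close> by (simp add: T_def field_simps)
      have "\<eta> = t powr (1 / g) * ((2 * g * k) powr (- 1 / g) * t powr (- 1 / g))"
        using elim by (simp add: \<eta>_def powr_minus)
      also have "\<dots> = t powr (1 / g) * (2 * g * k * t) powr (- 1 / g)"
        using elim g \<open>k > 0\<close> by (simp add: powr_mult)
      also have "\<dots> \<le> t powr (1 / g) * (f 0 powr (- g) + g * k * t) powr (- 1 / g)"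
        using \<open>f 0 powr (- g) \<le> g * k * t\<close> g \<open>k > 0\<close> elim
        by (intro mult_left_mono powr_mono2') (auto intro: add_nonneg_pos)
      also have "\<dots> \<le> t powr (1 / g) * f t"
        using low elim by (intro mult_left_mono) auto
      finally show ?case
        by (simp add: f_def)
    qed
  qed
  ultimately show ?thesis
    unfolding g by blast
qed

end

section \<open>Choice of the exponent in the two cases\<close>

theorem theorem3p1:
  fixes \<alpha> \<beta> c d l :: real
  assumes "\<alpha> > 0" and "\<beta> > 0" and "c > 0" and "d > 0" and "l \<ge> 0" and "\<alpha> > l"
  shows
    "(\<exists>\<eta>>0. \<forall>u. is_solution \<alpha> \<beta> c d l u \<longrightarrow> energy \<beta> d l u 0 \<noteq> 0 \<longrightarrow>
        Liminf at_top (\<lambda>t. ereal (t powr ((l + 2) / (\<alpha> - l)) * energy \<beta> d l u t)) \<ge> ereal \<eta>)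
     \<and> (\<alpha> \<ge> (\<beta> * (1 + l) + l) / (\<beta> + 2) \<longrightarrow>
         (\<exists>C :: real \<Rightarrow> real. \<forall>u. is_solution \<alpha> \<beta> c d l u \<longrightarrow>
            (\<forall>t\<ge>1. energy \<beta> d l u t
                     \<le> C (energy \<beta> d l u 0) * t powr (- ((l + 2) / (\<alpha> - l)))))
        )
     \<and> (\<alpha> < (\<beta> * (1 + l) + l) / (\<beta> + 2) \<longrightarrow>
         (\<exists>C :: real \<Rightarrow> real. \<forall>u. is_solution \<alpha> \<beta> c d l u \<longrightarrow>
            (\<forall>t\<ge>1. energy \<beta> d l u t
                     \<le> C (energy \<beta> d l u 0)
                        * t powr (- ((\<alpha> + 1) * (\<beta> + 2) / (\<beta> - \<alpha>)))))
        )"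
proof (intro conjI impI)
  show "\<exists>\<eta>>0. \<forall>u. is_solution \<alpha> \<beta> c d l u \<longrightarrow> energy \<beta> d l u 0 \<noteq> 0 \<longrightarrow>
        Liminf at_top (\<lambda>t. ereal (t powr ((l + 2) / (\<alpha> - l)) * energy \<beta> d l u t)) \<ge> ereal \<eta>"
    by (rule energy_lower[OF assms])
next
  assume "\<alpha> \<ge> (\<beta> * (1 + l) + l) / (\<beta> + 2)"
  then have le: "\<beta> - l \<le> (\<alpha> - l) * (\<beta> + 2)"
    using assms by (simp add: field_simps)
  \<comment> \<open>This makes the second constraint on \<theta> in \<open>energy_upper\<close> an
    equality; the last constraint then reduces to \<open>le\<close>.\<close>
  define \<theta> where "\<theta> = (\<beta> + 2) * (\<alpha> - l) / (l + 2)"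
  have \<theta>: "\<theta> > 0" "\<theta> * (l + 2) = (\<beta> + 2) * (\<alpha> - l)" "(\<beta> + 2) / \<theta> = (l + 2) / (\<alpha> - l)"
    using assms by (simp_all add: \<theta>_def)
  \<comment> \<open>Both constraints on \<open>\<theta>\<close> coincide at the threshold for \<open>\<alpha>\<close>, so their difference has this factor.\<close>
  have "0 \<le> ((\<alpha> - l) * (\<beta> + 2) - (\<beta> - l)) * (\<alpha> + 2)"
    using le assms by simp
  then have "(\<beta> - \<alpha>) * (l + 2) \<le> (\<beta> + 2) * (\<alpha> - l) * (\<alpha> + 1)"
    by (simp add: algebra_simps)
  then have "\<beta> - \<alpha> \<le> \<theta> * (\<alpha> + 1)"
    using assms by (simp add: \<theta>_def field_simps)
  moreover have "\<beta> + 2 \<le> (\<theta> + 1) * (l + 2)"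
    using le \<theta> by (simp add: algebra_simps)
  ultimately show "\<exists>C :: real \<Rightarrow> real. \<forall>u. is_solution \<alpha> \<beta> c d l u \<longrightarrow>
            (\<forall>t\<ge>1. energy \<beta> d l u t
                     \<le> C (energy \<beta> d l u 0) * t powr (- ((l + 2) / (\<alpha> - l))))"
    using energy_upper[OF assms \<theta>(1)] \<theta> by simp
next
  assume "\<alpha> < (\<beta> * (1 + l) + l) / (\<beta> + 2)"
  then have less: "(\<alpha> - l) * (\<beta> + 2) < \<beta> - l"
    using assms by (simp add: field_simps)
  \<comment> \<open>Case (ii) forces \<beta> > \<alpha>, without which the exponent chosen next
    would not be positive.\<close>
  have "(\<alpha> - l) * 1 \<le> (\<alpha> - l) * (\<beta> + 2)"
    using assms by (intro mult_left_mono) auto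
  then have "\<beta> > \<alpha>"
    using less by simp
  \<comment> \<open>Now the first constraint is an equality, and the last one again follows from the
    threshold condition.\<close>
  define \<theta> where "\<theta> = (\<beta> - \<alpha>) / (\<alpha> + 1)"
  have \<theta>: "\<theta> > 0" "\<theta> * (\<alpha> + 1) = \<beta> - \<alpha>" "(\<beta> + 2) / \<theta> = (\<alpha> + 1) * (\<beta> + 2) / (\<beta> - \<alpha>)"
    using assms \<open>\<beta> > \<alpha>\<close> by (simp_all add: \<theta>_def)
  have "\<beta> + 2 \<le> (\<theta> + 1) * (l + 2)"
    using less assms by (simp add: \<theta>_def field_simps)
  moreover have "(\<beta> + 2) * (\<alpha> - l) \<le> \<theta> * (l + 2)"
  proof -
    \<comment> \<open>The same factorisation as in case (i), with the opposite sign.\<close>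
    have "((\<alpha> - l) * (\<beta> + 2) - (\<beta> - l)) * (\<alpha> + 2) \<le> 0"
      using less assms by (intro mult_nonpos_nonneg) auto
    then have "(\<beta> + 2) * (\<alpha> - l) * (\<alpha> + 1) \<le> (\<beta> - \<alpha>) * (l + 2)"
      by (simp add: algebra_simps)
    then show ?thesis
      using assms by (simp add: \<theta>_def field_simps)
  qed
  ultimately show "\<exists>C :: real \<Rightarrow> real. \<forall>u. is_solution \<alpha> \<beta> c d l u \<longrightarrow>
            (\<forall>t\<ge>1. energy \<beta> d l u t
                     \<le> C (energy \<beta> d l u 0)
                        * t powr (- ((\<alpha> + 1) * (\<beta> + 2) / (\<beta> - \<alpha>))))"
    using energy_upper[OF assms \<theta>(1)] \<theta> by simp
qed

end
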